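(* Let $\{f_k\}_{k=1}^\infty$ be a Riesz sequence in a Hilbert space $\mathcal{H}$ with bounds $A,B$, and let $S$ be its frame operator on $\overline{\mathrm{span}}\{f_k\}_{k=1}^\infty$. Let $\{g_k\}_{k=1}^\infty$ be a sequence in $\mathcal{H}$ which satisfies $\mu:=\sum_{k=1}^\infty\|f_k-g_k\|\,\|S^{-1}(f_k)\|<1$. Then $\{g_k\}_{k=1}^\infty$ is a Riesz sequence with bounds $A(1-\mu)^2$ and $B\left(1+\frac{\sqrt{\lambda}}{\sqrt{B}}\right)^2$, where $\lambda:=\sum_{k=1}^\infty\|f_k-g_k\|^2$.
   Context: A sequence $\{f_k\}_{k=1}^\infty$ in a Hilbert space $\mathcal{H}$ is a Riesz sequence with bounds $A,B$ (where $A,B>0$; $A$ lower, $B$ upper) if $A\sum_{k=1}^n|c_k|^2\le\|\sum_{k=1}^nc_kf_k\|^2\le B\sum_{k=1}^n|c_k|^2$ for every finite scalar sequence $\{c_k\}_{k=1}^n$. A Riesz sequence is a Riesz basis, in particular a frame, for its closed linear span $L=\overline{\mathrm{span}}\{f_k\}_{k=1}^\infty$; its frame operator is $S:L\to L$, $S(f)=\sum_{k=1}^\infty\langle f,f_k\rangle f_k$, which is bounded and invertible on $L$. *)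

theory Defs
  imports "HOL-Analysis.Analysis"
begin

text \<open>
  Scalar fields, treating the real and the complex case uniformly. By Gelfand--Mazur, a
  \<open>real_normed_field\<close> is isometrically isomorphic to \<open>\<real>\<close> or \<open>\<complex>\<close>, and the second axiom
  below forces the involution to be the identity or complex conjugation, respectively.
\<close>

class rc_scalar = real_normed_field +
  fixes sconj :: "'a \<Rightarrow> 'a"
  assumes sconj_add: "sconj (x + y) = sconj x + sconj y"
    and mult_sconj: "x * sconj x = ((norm x)\<^sup>2) *\<^sub>R 1"

instantiation real :: rc_scalar
begin
definition sconj_real :: "real \<Rightarrow> real" where "sconj_real x = x"
instance by standard (auto simp: sconj_real_def power2_eq_square)
end

instantiation complex :: rc_scalar
begin
definition sconj_complex :: "complex \<Rightarrow> complex" where "sconj_complex = cnj"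
instance by standard (auto simp: sconj_complex_def complex_norm_square scaleR_conv_of_real simp del: of_real_power)
end

text \<open>
  Hilbert spaces over such a field, with inner product linear in the first argument. The class
  \<open>banach\<close> supplies norm, topology and completeness; the axioms \<open>smul_of_real\<close> and \<open>ip_self\<close>
  tie its real scalar multiplication and its norm to \<open>smul\<close> and \<open>ip\<close>.
\<close>

locale hilbert_space = vector_space smul
  for smul :: "'k::rc_scalar \<Rightarrow> 'v::banach \<Rightarrow> 'v" +
  fixes ip :: "'v \<Rightarrow> 'v \<Rightarrow> 'k"
  assumes smul_of_real: "smul (of_real r) x = r *\<^sub>R x"
    and ip_add_left: "ip (x + y) z = ip x z + ip y z"
    and ip_smul_left: "ip (smul a x) y = a * ip x y"
    and ip_commute: "ip y x = sconj (ip x y)"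
    and ip_self: "ip x x = of_real ((norm x)\<^sup>2)"

lemma hilbert_space_real:
  "hilbert_space (scaleR :: real \<Rightarrow> 'v \<Rightarrow> 'v::{real_inner, banach}) inner"
  by unfold_locales
    (auto simp: algebra_simps inner_commute sconj_real_def power2_norm_eq_inner)

lemma hilbert_space_complex:
  "hilbert_space ((*) :: complex \<Rightarrow> complex \<Rightarrow> complex) (\<lambda>x y. x * cnj y)"
  by unfold_locales
    (auto simp: algebra_simps sconj_complex_def complex_norm_square scaleR_conv_of_real
          simp del: of_real_power)

text \<open>Sequences are indexed from \<open>0\<close>.\<close>

definition riesz_sequence ::
    "('k::rc_scalar \<Rightarrow> 'v::real_normed_vector \<Rightarrow> 'v) \<Rightarrow> (nat \<Rightarrow> 'v) \<Rightarrow> real \<Rightarrow> real \<Rightarrow> bool"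
  where "riesz_sequence smul f A B \<longleftrightarrow> A > 0 \<and> B > 0 \<and>
    (\<forall>(n::nat) (c :: nat \<Rightarrow> 'k).
       A * (\<Sum>k<n. (norm (c k))\<^sup>2) \<le> (norm (\<Sum>k<n. smul (c k) (f k)))\<^sup>2 \<and>
       (norm (\<Sum>k<n. smul (c k) (f k)))\<^sup>2 \<le> B * (\<Sum>k<n. (norm (c k))\<^sup>2))"

definition closed_span ::
    "('k::rc_scalar \<Rightarrow> 'v::real_normed_vector \<Rightarrow> 'v) \<Rightarrow> (nat \<Rightarrow> 'v) \<Rightarrow> 'v set"
  where "closed_span smul f = closure (module.span smul (range f))"

text \<open>
  The series makes sense as a total function; as the operator \<open>S\<close> on \<open>L = closed_span smul f\<close>
  it is restricted to \<open>L\<close>, so that its inverse is \<open>inv_into L S\<close>.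
\<close>

definition frame_operator ::
    "('k::rc_scalar \<Rightarrow> 'v::real_normed_vector \<Rightarrow> 'v) \<Rightarrow> ('v \<Rightarrow> 'v \<Rightarrow> 'k) \<Rightarrow> (nat \<Rightarrow> 'v) \<Rightarrow> 'v \<Rightarrow> 'v"
  where "frame_operator smul ip f x = (\<Sum>k. smul (ip x (f k)) (f k))"

definition frame_operator_inv ::
    "('k::rc_scalar \<Rightarrow> 'v::real_normed_vector \<Rightarrow> 'v) \<Rightarrow> ('v \<Rightarrow> 'v \<Rightarrow> 'k) \<Rightarrow> (nat \<Rightarrow> 'v) \<Rightarrow> 'v \<Rightarrow> 'v"
  where "frame_operator_inv smul ip f =
    inv_into (closed_span smul f) (frame_operator smul ip f)"

end

theory Submission
  imports Defs
begin

text \<open>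
  The vectors \<open>h\<^sub>k = S\<inverse> f\<^sub>k\<close> are biorthogonal to \<open>f\<close>, so the coefficients of a finite
  combination \<open>F = \<Sum> c\<^sub>k f\<^sub>k\<close> satisfy \<open>\<bar>c\<^sub>k\<bar> = \<bar>\<langle>F, h\<^sub>k\<rangle>\<bar> \<le> \<parallel>F\<parallel> \<parallel>h\<^sub>k\<parallel>\<close>. Hence replacing \<open>f\<close> by \<open>g\<close>
  moves \<open>F\<close> by at most \<open>\<mu> \<parallel>F\<parallel>\<close>, which gives the lower bound; the upper bound is Cauchy--Schwarz.
  That \<open>f\<^sub>k\<close> lies in the range of \<open>S\<close> is seen by rescaling the component of \<open>f\<^sub>k\<close> orthogonal to
  the other \<open>f\<^sub>j\<close>.
\<close>

section \<open>Algebra of the conjugation on the scalar field\<close>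

lemma sconj_zero [simp]: "sconj (0 :: 'a::rc_scalar) = 0"
  using sconj_add[of "0::'a" 0] by simp

lemma sconj_minus: "sconj (- x) = - sconj (x :: 'a::rc_scalar)"
  using sconj_add[of x "- x"] by (simp add: eq_neg_iff_add_eq_0 add.commute)

lemma mult_sconj_of_real: "x * sconj x = of_real ((norm x)\<^sup>2)" for x :: "'a::rc_scalar"
  by (simp add: mult_sconj of_real_def)

text \<open>The norm axiom solved for the conjugate; at \<open>x = 0\<close> both sides vanish
  because division by zero yields zero. Multiplicativity of \<open>sconj\<close>, which is not an
  axiom of the class, then reduces to that of the norm.\<close>

lemma sconj_eq_divide: "sconj x = of_real ((norm x)\<^sup>2) / x" for x :: "'a::rc_scalar"
  using mult_sconj_of_real[of x] by (cases "x = 0") (auto simp: field_simps)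

lemma sconj_mult: "sconj (x * y) = sconj x * sconj y" for x y :: "'a::rc_scalar"
  by (simp add: sconj_eq_divide norm_mult power_mult_distrib)

section \<open>Inner product calculus and the Cauchy-Schwarz inequality\<close>

context hilbert_space
begin

lemma ip_zero_left [simp]: "ip 0 y = 0"
  using ip_add_left[of 0 0 y] by simp

lemma ip_minus_left: "ip (- x) y = - ip x y"
  using ip_add_left[of x "- x" y] by (simp add: eq_neg_iff_add_eq_0 add.commute)

lemma ip_diff_left: "ip (x - y) z = ip x z - ip y z"
  using ip_add_left[of x "- y" z] by (simp add: ip_minus_left)

lemma ip_add_right: "ip z (x + y) = ip z x + ip z y"
  by (metis ip_add_left ip_commute sconj_add)

lemma ip_minus_right: "ip x (- y) = - ip x y"
  by (metis ip_minus_left ip_commute sconj_minus)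

lemma ip_diff_right: "ip z (x - y) = ip z x - ip z y"
  using ip_add_right[of z x "- y"] by (simp add: ip_minus_right)

lemma ip_smul_right: "ip x (smul a y) = sconj a * ip x y"
  by (metis ip_smul_left ip_commute sconj_mult)

lemma ip_zero_right [simp]: "ip x 0 = 0"
  by (metis ip_commute ip_zero_left sconj_zero)

lemma ip_sum_left: "ip (sum u I) y = (\<Sum>i\<in>I. ip (u i) y)"
  by (induction I rule: infinite_finite_induct) (auto simp: ip_add_left)

lemma ip_sum_right: "ip y (sum u I) = (\<Sum>i\<in>I. ip y (u i))"
  by (induction I rule: infinite_finite_induct) (auto simp: ip_add_right)

text \<open>The axioms link \<open>smul\<close> with the norm directly only for real scalars. For
  general ones the identity comes from expanding the inner product of \<open>smul a x\<close> with
  itself.\<close>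

lemma norm_smul: "norm (smul a x) = norm a * norm x"
proof -
  have "of_real ((norm (smul a x))\<^sup>2) = (of_real ((norm a * norm x)\<^sup>2) :: 'k)"
    unfolding power_mult_distrib of_real_mult mult_sconj_of_real[symmetric]
    unfolding ip_self[symmetric] ip_smul_left ip_smul_right
    by (simp only: mult_ac)
  then show ?thesis
    by (simp only: of_real_eq_iff) (simp add: power2_eq_iff_nonneg)
qed

lemma parallelogram:
  fixes x y :: 'v
  shows "(norm (x + y))\<^sup>2 + (norm (x - y))\<^sup>2 = 2 * (norm x)\<^sup>2 + 2 * (norm y)\<^sup>2"
proof -
  have "of_real ((norm (x + y))\<^sup>2 + (norm (x - y))\<^sup>2)
      = (of_real (2 * (norm x)\<^sup>2 + 2 * (norm y)\<^sup>2) :: 'k)"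
    unfolding of_real_add of_real_mult of_real_numeral ip_self[symmetric]
    by (simp add: ip_add_left ip_add_right ip_diff_left ip_diff_right algebra_simps)
  then show ?thesis by (simp only: of_real_eq_iff)
qed

text \<open>Pythagoras for removing from \<open>x\<close> its component along \<open>y\<close>.
  Nonnegativity of the left side gives Cauchy-Schwarz; the size of the decrease gives orthogonality
  for the nearest-point argument.\<close>

lemma norm_minus_component:
  assumes "y \<noteq> 0"
  shows "(norm (x - smul (ip x y / of_real ((norm y)\<^sup>2)) y))\<^sup>2
    = (norm x)\<^sup>2 - (norm (ip x y))\<^sup>2 / (norm y)\<^sup>2"
proof -
  define N where "N = (norm y)\<^sup>2"
  define t where "t = ip x y / of_real N"
  have N: "N > 0" using assms by (simp add: N_def)
  have "(norm t)\<^sup>2 * N = (norm (ip x y))\<^sup>2 / N"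
    using N by (simp add: t_def norm_divide power_divide power2_eq_square)
  then have t: "t * sconj t * of_real N = of_real ((norm (ip x y))\<^sup>2 / N)"
    unfolding mult_sconj_of_real of_real_mult[symmetric] by (rule arg_cong)
  have "ip x y = t * of_real N" using N by (simp add: t_def)
  \<comment> \<open>In the expansion of the squared norm the two cross terms and the quadratic term
    all have this same value, so exactly one copy of it stays subtracted.\<close>
  then have 1: "sconj t * ip x y = of_real ((norm (ip x y))\<^sup>2 / N)"
    using t by (metis mult.assoc mult.commute)
  have 2: "t * ip y x = of_real ((norm (ip x y))\<^sup>2 / N)"
    unfolding ip_commute[of y x] t_def times_divide_eq_left mult_sconj_of_real of_real_divide ..
  have 3: "sconj t * (t * ip y y) = of_real ((norm (ip x y))\<^sup>2 / N)"
    using t unfolding ip_self N_def by (simp only: mult_ac)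
  have "of_real ((norm (x - smul t y))\<^sup>2) = (of_real ((norm x)\<^sup>2 - (norm (ip x y))\<^sup>2 / N) :: 'k)"
    unfolding of_real_diff
    unfolding ip_self[symmetric] ip_diff_left ip_diff_right ip_smul_left ip_smul_right
    by (simp add: right_diff_distrib 1 2 3)
  then show ?thesis by (simp only: of_real_eq_iff t_def N_def)
qed

lemma Cauchy_Schwarz: "norm (ip x y) \<le> norm x * norm y"
proof (cases "y = 0")
  case False
  have "0 \<le> (norm x)\<^sup>2 - (norm (ip x y))\<^sup>2 / (norm y)\<^sup>2"
    unfolding norm_minus_component[OF False, symmetric] by simp
  then have "(norm (ip x y))\<^sup>2 \<le> (norm x * norm y)\<^sup>2"
    using False by (simp add: field_simps power_mult_distrib)
  then show ?thesis by (rule power2_le_imp_le) simp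
qed simp

section \<open>Orthogonal projection onto the closure of a subspace\<close>

text \<open>A sequence in \<open>N\<close> minimising the distance to \<open>x\<close> is Cauchy by
  the parallelogram law. If the residual at its limit \<open>p\<close> were not orthogonal to some
  \<open>m\<close>, removing the component along \<open>m\<close> would push the distance below the
  infimum.\<close>

lemma exists_closure_projection:
  assumes N: "subspace N"
  shows "\<exists>p \<in> closure N. \<forall>m \<in> N. ip (x - p) m = 0"
proof -
  define D where "D = (\<lambda>m. (norm (x - m))\<^sup>2) ` N"
  define d where "d = Inf D"
  have ne: "D \<noteq> {}" using subspace_0[OF N] by (auto simp: D_def)
  have bdd: "bdd_below D" by (rule bdd_belowI[of _ 0]) (auto simp: D_def)
  have d_le: "d \<le> (norm (x - m))\<^sup>2" if "m \<in> N" for m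
    unfolding d_def using bdd that by (auto intro: cInf_lower simp: D_def)
  have "\<exists>m \<in> N. (norm (x - m))\<^sup>2 < d + 1 / real (Suc n)" for n
    using cInf_lessD[OF ne, of "d + 1 / real (Suc n)", folded d_def] by (auto simp: D_def)
  then obtain u where uN: "\<And>n. u n \<in> N"
    and u: "\<And>n. (norm (x - u n))\<^sup>2 < d + 1 / real (Suc n)"
    by metis
  have dist: "(norm (u i - u j))\<^sup>2 \<le> 2 / real (Suc i) + 2 / real (Suc j)" for i j
  proof -
    \<comment> \<open>The midpoint lies in \<open>N\<close>, so its squared distance to
      \<open>x\<close> is at least \<open>d\<close>. In the parallelogram law the four copies of
      \<open>d\<close> cancel and only the errors remain.\<close>
    define m where "m = smul (of_real (1/2)) (u i + u j)"
    have m: "m \<in> N" unfolding m_def using N uN by (intro subspace_scale subspace_add)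
    have "(x - u j) + (x - u i) = 2 *\<^sub>R (x - m)"
      by (simp add: m_def smul_of_real algebra_simps scaleR_2 del: of_real_divide)
    moreover have "(x - u j) - (x - u i) = u i - u j" by simp
    ultimately have "4 * (norm (x - m))\<^sup>2 + (norm (u i - u j))\<^sup>2
        = 2 * (norm (x - u j))\<^sup>2 + 2 * (norm (x - u i))\<^sup>2"
      using parallelogram[of "x - u j" "x - u i"] by (simp add: power_mult_distrib)
    then show ?thesis using d_le[OF m] u[of i] u[of j] by simp
  qed
  have "Cauchy u"
  proof (rule metric_CauchyI)
    fix e :: real assume e: "e > 0"
    obtain M where M: "4 / e\<^sup>2 < real M" using reals_Archimedean2 by blast
    have *: "norm (u i - u j) < e" if "i \<ge> M" "j \<ge> M" for i j
    proof -
      have M0: "M > 0" using M e by (cases M) (auto simp: field_simps not_less)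
      have "(norm (u i - u j))\<^sup>2 \<le> 2 / real (Suc i) + 2 / real (Suc j)" by (rule dist)
      also have "\<dots> \<le> 2 / real M + 2 / real M"
        using that M0 by (intro add_mono divide_left_mono) auto
      also have "\<dots> < e\<^sup>2" using M M0 e by (simp add: field_simps)
      finally show ?thesis using e by (simp add: power2_less_imp_less)
    qed
    then show "\<exists>M. \<forall>m\<ge>M. \<forall>n\<ge>M. dist (u m) (u n) < e"
      unfolding dist_norm by blast
  qed
  then obtain p where p: "u \<longlonglongrightarrow> p" using Cauchy_convergent_iff convergent_def by blast
  have "p \<in> closure N" using uN p closure_sequential by blast
  have lim_d: "(\<lambda>n. d + 1 / real (Suc n)) \<longlonglongrightarrow> d + 0"
    using LIMSEQ_Suc[OF lim_1_over_n] by (intro tendsto_intros) simp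
  have "(\<lambda>n. (norm (x - u n))\<^sup>2) \<longlonglongrightarrow> (norm (x - p))\<^sup>2"
    using p by (intro tendsto_intros)
  from lim_mono[OF less_imp_le[OF u] this lim_d]
  have p_le: "(norm (x - p))\<^sup>2 \<le> d" by simp
  have "ip (x - p) m = 0" if m: "m \<in> N" for m
  proof (cases "m = 0")
    case False
    define t where "t = ip (x - p) m / of_real ((norm m)\<^sup>2)"
    \<comment> \<open>The point \<open>p + smul t m\<close> may lie outside \<open>N\<close>, where
      the infimum says nothing directly; the bound is taken along \<open>u n\<close> and passed to
      the limit.\<close>
    have "d \<le> (norm (x - (u n + smul t m)))\<^sup>2" for n
      using N uN m by (intro d_le subspace_add subspace_scale)
    moreover have "(\<lambda>n. (norm (x - (u n + smul t m)))\<^sup>2) \<longlonglongrightarrow> (norm (x - (p + smul t m)))\<^sup>2"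
      using p by (intro tendsto_intros)
    ultimately have "d \<le> (norm (x - (p + smul t m)))\<^sup>2"
      by (meson LIMSEQ_le_const)
    also have "x - (p + smul t m) = (x - p) - smul t m" by simp
    finally have "(norm (ip (x - p) m))\<^sup>2 / (norm m)\<^sup>2 \<le> 0"
      using p_le norm_minus_component[OF False, of "x - p"] by (simp add: t_def)
    then show ?thesis using False
      by (simp add: divide_le_0_iff)
  qed simp
  with \<open>p \<in> closure N\<close> show ?thesis by blast
qed

section \<open>Bessel bound, convergence and uniqueness of Riesz expansions\<close>

lemma riesz_sequence_lower:
  assumes "riesz_sequence smul f A B"
  shows "A * (\<Sum>k<n. (norm (c k))\<^sup>2) \<le> (norm (\<Sum>k<n. smul (c k) (f k)))\<^sup>2"
  using assms unfolding riesz_sequence_def by blast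

lemma riesz_sequence_upper:
  assumes "riesz_sequence smul f A B"
  shows "(norm (\<Sum>k<n. smul (c k) (f k)))\<^sup>2 \<le> B * (\<Sum>k<n. (norm (c k))\<^sup>2)"
  using assms unfolding riesz_sequence_def by blast

text \<open>Duality: pairing \<open>x\<close> with \<open>y\<close>, the combination having the
  coefficients \<open>ip x (f k)\<close>, gives exactly \<open>s\<close>, while the upper Riesz
  bound controls \<open>y\<close> by \<open>B * s\<close>. Cauchy-Schwarz leaves \<open>s\<close>
  squared against \<open>s\<close>, and one factor cancels.\<close>

lemma Bessel_inequality:
  assumes R: "riesz_sequence smul f A B"
  shows "(\<Sum>k<n. (norm (ip x (f k)))\<^sup>2) \<le> B * (norm x)\<^sup>2"
proof -
  define s where "s = (\<Sum>k<n. (norm (ip x (f k)))\<^sup>2)"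
  define y where "y = (\<Sum>k<n. smul (ip x (f k)) (f k))"
  have s0: "s \<ge> 0" unfolding s_def by (intro sum_nonneg) simp
  have y: "(norm y)\<^sup>2 \<le> B * s"
    unfolding y_def s_def by (rule riesz_sequence_upper[OF R])
  have "ip x y = of_real s"
    unfolding y_def s_def of_real_sum ip_sum_right ip_smul_right
    by (intro sum.cong refl) (metis mult.commute mult_sconj_of_real)
  then have "s \<le> norm x * norm y" using Cauchy_Schwarz[of x y] s0 by simp
  then have "s\<^sup>2 \<le> (norm x)\<^sup>2 * (norm y)\<^sup>2"
    using s0 by (metis power_mono power_mult_distrib)
  also have "\<dots> \<le> (norm x)\<^sup>2 * (B * s)" using y by (intro mult_left_mono) auto
  finally have *: "s * s \<le> (B * (norm x)\<^sup>2) * s" by (simp add: power2_eq_square mult_ac)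
  have "B > 0" using R by (simp add: riesz_sequence_def)
  then have "s \<le> B * (norm x)\<^sup>2"
    using * s0 by (cases "s = 0") auto
  then show ?thesis by (simp add: s_def)
qed

lemma riesz_sequence_summable:
  assumes R: "riesz_sequence smul f A B" and c: "summable (\<lambda>k. (norm (c k))\<^sup>2)"
  shows "summable (\<lambda>k. smul (c k) (f k))"
  unfolding summable_Cauchy
proof (intro allI impI)
  fix e :: real assume e: "e > 0"
  have B: "B > 0" using R by (simp add: riesz_sequence_def)
  have "e\<^sup>2 / B > 0" using e B by simp
  then obtain N where N: "\<And>m n. m \<ge> N \<Longrightarrow> norm (\<Sum>k=m..<n. (norm (c k))\<^sup>2) < e\<^sup>2 / B"
    using c unfolding summable_Cauchy by blast
  have "norm (\<Sum>k=m..<n. smul (c k) (f k)) < e" if m: "m \<ge> N" for m n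
  proof -
    \<comment> \<open>The Riesz bounds concern sums starting at 0, so a block from \<open>m\<close>
      to \<open>n\<close> is padded with zero coefficients below \<open>m\<close>.\<close>
    define b where "b k = (if m \<le> k then c k else 0)" for k
    have 1: "(\<Sum>k=m..<n. smul (c k) (f k)) = (\<Sum>k<n. smul (b k) (f k))"
      and 2: "(\<Sum>k=m..<n. (norm (c k))\<^sup>2) = (\<Sum>k<n. (norm (b k))\<^sup>2)"
      by (auto simp: b_def intro!: sum.mono_neutral_cong_left)
    have "(norm (\<Sum>k=m..<n. smul (c k) (f k)))\<^sup>2 \<le> B * (\<Sum>k=m..<n. (norm (c k))\<^sup>2)"
      unfolding 1 2 by (rule riesz_sequence_upper[OF R])
    also have "\<dots> < e\<^sup>2" using N[OF m, of n] B by (simp add: pos_less_divide_eq mult.commute abs_of_nonneg sum_nonneg)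
    finally show ?thesis using e by (simp add: power2_less_imp_less)
  qed
  then show "\<exists>N. \<forall>m\<ge>N. \<forall>n. norm (\<Sum>k=m..<n. smul (c k) (f k)) < e" by blast
qed

text \<open>Bessel makes the coefficients square summable, so the series defining the frame operator
  converges at every \<open>x\<close> and its value is a genuine sum.\<close>

lemma frame_operator_sums:
  assumes R: "riesz_sequence smul f A B"
  shows "(\<lambda>k. smul (ip x (f k)) (f k)) sums frame_operator smul ip f x"
proof -
  have "summable (\<lambda>k. (norm (ip x (f k)))\<^sup>2)"
    by (rule summableI_nonneg_bounded) (auto intro: Bessel_inequality[OF R])
  then show ?thesis
    unfolding frame_operator_def
    by (intro summable_sums riesz_sequence_summable[OF R])
qed

text \<open>The lower bound, applied to the differences of the coefficients, dominates each single
  difference by partial sums that tend to 0.\<close>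

lemma riesz_sequence_sums_unique:
  assumes R: "riesz_sequence smul f A B"
    and c: "(\<lambda>k. smul (c k) (f k)) sums x" and b: "(\<lambda>k. smul (b k) (f k)) sums x"
  shows "c = b"
proof
  fix j
  have A: "A > 0" using R by (simp add: riesz_sequence_def)
  have "(\<lambda>n. (\<Sum>k<n. smul (c k - b k) (f k))) \<longlonglongrightarrow> 0"
    using sums_diff[OF c b] by (simp add: sums_def scale_left_diff_distrib)
  then have lim: "(\<lambda>n. (norm (\<Sum>k<n. smul (c k - b k) (f k)))\<^sup>2) \<longlonglongrightarrow> (norm (0::'v))\<^sup>2"
    by (intro tendsto_intros)
  have "A * (norm (c j - b j))\<^sup>2 \<le> (norm (\<Sum>k<n. smul (c k - b k) (f k)))\<^sup>2" if "n \<ge> Suc j" for n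
  proof -
    have "(norm (c j - b j))\<^sup>2 \<le> (\<Sum>k<n. (norm (c k - b k))\<^sup>2)"
      using that by (intro member_le_sum) auto
    then have "A * (norm (c j - b j))\<^sup>2 \<le> A * (\<Sum>k<n. (norm (c k - b k))\<^sup>2)" using A by simp
    also have "\<dots> \<le> (norm (\<Sum>k<n. smul (c k - b k) (f k)))\<^sup>2"
      by (rule riesz_sequence_lower[OF R])
    finally show ?thesis .
  qed
  then have "A * (norm (c j - b j))\<^sup>2 \<le> (norm (0::'v))\<^sup>2"
    using lim LIMSEQ_le_const by blast
  then show "c j = b j" using A by (simp add: mult_le_0_iff)
qed

section \<open>A biorthogonal vector inside the closed span\<close>

text \<open>Puts elements of the span into the form to which the Riesz bounds apply. Letting the
  identity hold for all \<open>N\<close> beyond \<open>n\<close> allows two representations to be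
  brought to a common length.\<close>

lemma span_image_coefficients:
  fixes f :: "nat \<Rightarrow> 'v"
  assumes "x \<in> span (f ` I)"
  shows "\<exists>n c. (\<forall>j. j \<notin> I \<longrightarrow> c j = 0) \<and> (\<forall>N\<ge>n. x = (\<Sum>j<N. smul (c j) (f j)))"
  using assms
proof (induction rule: span_induct)
  case base
  show ?case unfolding subspace_def mem_Collect_eq
  proof (intro conjI ballI allI)
    show "\<exists>n c. (\<forall>j. j \<notin> I \<longrightarrow> c j = 0) \<and> (\<forall>N\<ge>n. 0 = (\<Sum>j<N. smul (c j) (f j)))"
      by (intro exI[of _ 0] exI[of _ "\<lambda>_. 0"]) simp
  next
    fix x y
    assume "x \<in> {x. \<exists>n c. (\<forall>j. j \<notin> I \<longrightarrow> c j = 0) \<and> (\<forall>N\<ge>n. x = (\<Sum>j<N. smul (c j) (f j)))}"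
      "y \<in> {x. \<exists>n c. (\<forall>j. j \<notin> I \<longrightarrow> c j = 0) \<and> (\<forall>N\<ge>n. x = (\<Sum>j<N. smul (c j) (f j)))}"
    then obtain n c m b where
      "\<forall>j. j \<notin> I \<longrightarrow> c j = 0" "\<forall>N\<ge>n. x = (\<Sum>j<N. smul (c j) (f j))"
      "\<forall>j. j \<notin> I \<longrightarrow> b j = 0" "\<forall>N\<ge>m. y = (\<Sum>j<N. smul (b j) (f j))"
      by auto
    then show "\<exists>n c. (\<forall>j. j \<notin> I \<longrightarrow> c j = 0) \<and> (\<forall>N\<ge>n. x + y = (\<Sum>j<N. smul (c j) (f j)))"
      by (intro exI[of _ "max n m"] exI[of _ "\<lambda>j. c j + b j"])
        (auto simp: scale_left_distrib sum.distrib)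
  next
    fix a x
    assume "x \<in> {x. \<exists>n c. (\<forall>j. j \<notin> I \<longrightarrow> c j = 0) \<and> (\<forall>N\<ge>n. x = (\<Sum>j<N. smul (c j) (f j)))}"
    then obtain n c where
      "\<forall>j. j \<notin> I \<longrightarrow> c j = 0" "\<forall>N\<ge>n. x = (\<Sum>j<N. smul (c j) (f j))"
      by auto
    then show "\<exists>n c. (\<forall>j. j \<notin> I \<longrightarrow> c j = 0) \<and> (\<forall>N\<ge>n. smul a x = (\<Sum>j<N. smul (c j) (f j)))"
      by (intro exI[of _ n] exI[of _ "\<lambda>j. a * c j"])
        (auto simp: scale_sum_right)
  qed
next
  case (step x)
  then obtain i where i: "i \<in> I" "x = f i" by blast
  have "(\<Sum>j<N. smul (if j = i then 1 else 0) (f j)) = x" if "N \<ge> Suc i" for N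
    using that i by (simp add: if_distrib[of "\<lambda>a. smul a _"] cong: if_cong)
  then show ?case
    using i by (intro exI[of _ "Suc i"] exI[of _ "\<lambda>j. if j = i then 1 else 0"]) auto
qed

text \<open>Let \<open>e\<close> be the component of \<open>f k\<close> orthogonal to the other
  vectors. The lower Riesz bound keeps \<open>f k\<close> at squared distance at least
  \<open>A\<close> from their span, so \<open>e\<close> is nonzero; its inner product with
  \<open>f k\<close> is its squared norm, and dividing by that gives \<open>h\<close>.\<close>

lemma exists_biorthogonal:
  fixes f :: "nat \<Rightarrow> 'v"
  assumes R: "riesz_sequence smul f A B"
  shows "\<exists>h \<in> closed_span smul f. \<forall>j. ip h (f j) = (if j = k then 1 else 0)"
proof -
  have A: "A > 0" using R by (simp add: riesz_sequence_def)
  define N where "N = span (f ` (- {k}))"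
  have sub: "N \<subseteq> span (range f)" unfolding N_def by (intro span_mono) auto
  obtain p where p: "p \<in> closure N" and orth: "\<And>m. m \<in> N \<Longrightarrow> ip (f k - p) m = 0"
    using exists_closure_projection[of N "f k"] by (auto simp: N_def)
  define e where "e = f k - p"
  obtain u where uN: "\<And>n. u n \<in> N" and u: "u \<longlonglongrightarrow> p"
    using p closure_sequential by metis
  have "A \<le> (norm (f k - m))\<^sup>2" if mN: "m \<in> N" for m
  proof -
    obtain n c where c: "\<forall>j. j \<notin> - {k} \<longrightarrow> c j = 0"
      and m: "\<forall>K\<ge>n. m = (\<Sum>j<K. smul (c j) (f j))"
      using span_image_coefficients[OF mN[unfolded N_def]] by (elim exE conjE)
    \<comment> \<open>Long enough both to represent \<open>m\<close> and to include the index
      \<open>k\<close>. Since \<open>c k = 0\<close>, the coefficient of \<open>f k\<close> in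
      \<open>f k - m\<close> is exactly 1.\<close>
    define K where "K = max n (Suc k)"
    define b where "b j = (if j = k then 1 else 0) - c j" for j
    have k: "k \<in> {..<K}" by (simp add: K_def)
    have "f k - m = (\<Sum>j<K. smul (b j) (f j))"
      using k m[rule_format, of K] unfolding b_def scale_left_diff_distrib sum_subtractf
      by (simp add: K_def if_distrib[of "\<lambda>a. smul a _"] cong: if_cong)
    moreover have "(norm (b k))\<^sup>2 \<le> (\<Sum>j<K. (norm (b j))\<^sup>2)"
      using k by (intro member_le_sum) auto
    then have "1 \<le> (\<Sum>j<K. (norm (b j))\<^sup>2)" using c by (simp add: b_def)
    ultimately show ?thesis
      using A riesz_sequence_lower[OF R, where n = K and c = b]
      by (metis mult.right_neutral mult_le_cancel_left_pos order_trans)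
  qed
  then have "A \<le> (norm (f k - u n))\<^sup>2" for n using uN by blast
  moreover have "(\<lambda>n. (norm (f k - u n))\<^sup>2) \<longlonglongrightarrow> (norm (f k - p))\<^sup>2"
    using u by (intro tendsto_intros)
  ultimately have "A \<le> (norm e)\<^sup>2" unfolding e_def by (meson LIMSEQ_le_const)
  then have e0: "norm e > 0" using A by auto
  define h where "h = (1 / (norm e)\<^sup>2) *\<^sub>R e"
  have h_smul: "h = smul (of_real (1 / (norm e)\<^sup>2)) e" by (simp add: h_def smul_of_real del: of_real_divide)
  \<comment> \<open>Replacing \<open>p\<close> by its approximants \<open>u n\<close> exhibits
    \<open>h\<close> as a limit of vectors in the span.\<close>
  have "(\<lambda>n. (1 / (norm e)\<^sup>2) *\<^sub>R (f k - u n)) \<longlonglongrightarrow> h"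
    unfolding h_def e_def using u by (intro tendsto_intros)
  moreover have "(1 / (norm e)\<^sup>2) *\<^sub>R (f k - u n) \<in> span (range f)" for n
    unfolding smul_of_real[symmetric]
    by (intro span_scale span_diff subsetD[OF sub uN] span_base rangeI)
  ultimately have h: "h \<in> closed_span smul f"
    unfolding closed_span_def closure_sequential
    by (intro exI[of _ "\<lambda>n. (1 / (norm e)\<^sup>2) *\<^sub>R (f k - u n)"]) simp
  have off: "ip e (f j) = 0" if "j \<noteq> k" for j
    using that by (auto simp: e_def N_def intro!: orth span_base)
  \<comment> \<open>Orthogonality is known on \<open>N\<close> only; Cauchy-Schwarz carries it over
    to the limit point \<open>p\<close>.\<close>
  have "norm (ip e (u n)) = 0" for n using orth[OF uN] by (simp add: e_def)
  then have le: "norm (ip e p) \<le> norm e * norm (p - u n)" for n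
    using Cauchy_Schwarz[of e "p - u n"] by (simp add: ip_diff_right)
  have lim: "(\<lambda>n. norm e * norm (p - u n)) \<longlonglongrightarrow> norm e * norm (p - p)"
    using u by (intro tendsto_intros)
  have "ip e p = 0"
    using LIMSEQ_le_const[OF lim, of "norm (ip e p)"] le by simp
  moreover have "f k = e + p" by (simp add: e_def)
  ultimately have "ip e (f k) = of_real ((norm e)\<^sup>2)"
    by (simp only: ip_add_right ip_self add_0_right)
  then have "ip h (f j) = (if j = k then 1 else 0)" for j
    using off e0 by (auto simp: h_smul ip_smul_left)
  with h show ?thesis by blast
qed

section \<open>The dual vectors given by the inverse frame operator\<close>

text \<open>A biorthogonal \<open>h\<close> is mapped to \<open>f k\<close>, so \<open>f k\<close>
  is in the range and \<open>inv_into\<close> returns a true preimage. Its inner products with the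
  \<open>f j\<close> are coefficients of an expansion of \<open>f k\<close>, and uniqueness
  identifies them with those of the trivial expansion.\<close>

lemma frame_operator_inv_biorthogonal:
  assumes R: "riesz_sequence smul f A B"
  shows "ip (frame_operator_inv smul ip f (f k)) (f j) = (if j = k then 1 else 0)"
proof -
  have delta: "(\<lambda>j. smul (if j = k then 1 else 0) (f j)) sums f k"
    using sums_finite[of "{k}" "\<lambda>j. smul (if j = k then 1 else 0) (f j)"] by simp
  obtain h where h: "h \<in> closed_span smul f" "\<And>j. ip h (f j) = (if j = k then 1 else 0)"
    using exists_biorthogonal[OF R] by blast
  then have "frame_operator smul ip f h = f k"
    using frame_operator_sums[OF R, of h] sums_unique2[OF _ delta] by simp
  then have "f k \<in> frame_operator smul ip f ` closed_span smul f" using h by force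
  then have "frame_operator smul ip f (frame_operator_inv smul ip f (f k)) = f k"
    unfolding frame_operator_inv_def by (rule f_inv_into_f)
  then have "(\<lambda>j. smul (ip (frame_operator_inv smul ip f (f k)) (f j)) (f j)) sums f k"
    using frame_operator_sums[OF R] by metis
  from fun_cong[OF riesz_sequence_sums_unique[OF R this delta]] show ?thesis .
qed

lemma norm_coefficient_le:
  assumes R: "riesz_sequence smul f A B" and k: "k < n"
  shows "norm (c k)
    \<le> norm (\<Sum>j<n. smul (c j) (f j)) * norm (frame_operator_inv smul ip f (f k))"
proof -
  have dual: "ip (f j) (frame_operator_inv smul ip f (f k)) = (if j = k then 1 else 0)" for j
  proof -
    have "sconj 1 = (1 :: 'k)" using mult_sconj[of "1 :: 'k"] by simp
    then show ?thesis
      by (subst ip_commute) (simp add: frame_operator_inv_biorthogonal[OF R])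
  qed
  have "ip (\<Sum>j<n. smul (c j) (f j)) (frame_operator_inv smul ip f (f k)) = c k"
    using k by (simp add: ip_sum_left ip_smul_left dual if_distrib cong: if_cong)
  then show ?thesis using Cauchy_Schwarz by metis
qed

text \<open>The dual vector has inner product 1 with \<open>f k\<close>, whose norm is at most
  \<open>sqrt B\<close>. This lower bound lets convergence of the series for \<open>\<mu>\<close>
  imply that of the sum of \<open>(norm (f k - g k))^2\<close>.\<close>

lemma norm_frame_operator_inv_ge:
  assumes R: "riesz_sequence smul f A B"
  shows "1 \<le> sqrt B * norm (frame_operator_inv smul ip f (f k))"
proof -
  have "(\<Sum>j<Suc k. smul (if j = k then 1 else 0) (f j)) = f k"
    "(\<Sum>j<Suc k. (norm (if j = k then 1 else (0::'k)))\<^sup>2) = 1"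
    by (simp_all add: if_distrib[of "\<lambda>a. smul a _"] if_distrib[of norm] if_distrib[of "\<lambda>a. a\<^sup>2"]
        cong: if_cong)
  then have "(norm (f k))\<^sup>2 \<le> B"
    using riesz_sequence_upper[OF R, where n = "Suc k" and c = "\<lambda>j. if j = k then 1 else 0"] by simp
  then have fk: "norm (f k) \<le> sqrt B" by (rule real_le_rsqrt)
  have "1 \<le> norm (frame_operator_inv smul ip f (f k)) * norm (f k)"
    using Cauchy_Schwarz[of "frame_operator_inv smul ip f (f k)" "f k"]
    by (simp add: frame_operator_inv_biorthogonal[OF R])
  also have "\<dots> \<le> norm (frame_operator_inv smul ip f (f k)) * sqrt B"
    using fk by (rule mult_left_mono) simp
  finally show ?thesis by (simp add: mult.commute)
qed

end

section \<open>The perturbation theorem\<close>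

theorem theorem2p5:
  fixes smul :: "'k::rc_scalar \<Rightarrow> 'v::banach \<Rightarrow> 'v"
    and ip :: "'v \<Rightarrow> 'v \<Rightarrow> 'k"
    and f g :: "nat \<Rightarrow> 'v"
    and A B \<mu> :: real
  assumes "hilbert_space smul ip"
    and "riesz_sequence smul f A B"
    and "(\<lambda>k. norm (f k - g k) * norm (frame_operator_inv smul ip f (f k))) sums \<mu>"
    and "\<mu> < 1"
  shows "\<exists>lam::real. (\<lambda>k. (norm (f k - g k))\<^sup>2) sums lam \<and>
    riesz_sequence smul g (A * (1 - \<mu>)\<^sup>2) (B * (1 + sqrt lam / sqrt B)\<^sup>2)"
proof -
  interpret hilbert_space smul ip by fact
  note R = assms(2)
  have A: "A > 0" and B: "B > 0" using R by (auto simp: riesz_sequence_def)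
  define h where "h k = norm (frame_operator_inv smul ip f (f k))" for k
  define d where "d k = norm (f k - g k)" for k
  have d0: "d k \<ge> 0" and h0: "h k \<ge> 0" for k by (simp_all add: d_def h_def)
  have sums: "(\<lambda>k. d k * h k) sums \<mu>" using assms(3) by (simp add: d_def h_def)
  have part: "(\<Sum>k<n. d k * h k) \<le> \<mu>" for n
    using sums d0 h0 by (metis finite_lessThan mult_nonneg_nonneg sum_le_suminf sums_iff)
  \<comment> \<open>Comparison for the convergence of \<open>lam\<close>: \<open>d k\<close> is at
    most \<open>sqrt B * (d k * h k)\<close>, and after squaring one of the two factors
    \<open>d k * h k\<close> is replaced by its bound \<open>\<mu>\<close>.\<close>
  have sq_le: "norm ((d k)\<^sup>2) \<le> B * \<mu> * (d k * h k)" for k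
  proof -
    have 1: "d k \<le> sqrt B * (d k * h k)"
      using mult_left_mono[OF norm_frame_operator_inv_ge[OF R, of k] d0[of k]]
      by (simp add: h_def mult_ac)
    have "d k * h k \<le> (\<Sum>j<Suc k. d j * h j)"
      using d0 h0 by (intro member_le_sum) auto
    then have 2: "d k * h k \<le> \<mu>" using part order_trans by blast
    have "(d k)\<^sup>2 \<le> (sqrt B * (d k * h k))\<^sup>2" using 1 d0 by (intro power_mono)
    also have "\<dots> = B * ((d k * h k) * (d k * h k))"
      using B by (simp add: power_mult_distrib power2_eq_square)
    also have "\<dots> \<le> B * (\<mu> * (d k * h k))"
      using B 2 d0 h0 by (intro mult_left_mono mult_right_mono mult_nonneg_nonneg) auto
    finally show ?thesis by (simp add: mult_ac)
  qed
  have "summable (\<lambda>k. B * \<mu> * (d k * h k))"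
    by (intro summable_mult sums_summable[OF sums])
  then have "summable (\<lambda>k. (d k)\<^sup>2)"
    using sq_le by (rule summable_comparison_test')
  then obtain lam where lam: "(\<lambda>k. (d k)\<^sup>2) sums lam" by (auto simp: summable_def)
  have part_lam: "(\<Sum>k<n. (d k)\<^sup>2) \<le> lam" for n
    using lam by (metis finite_lessThan sum_le_suminf sums_iff zero_le_power2)
  have lam0: "lam \<ge> 0" using part_lam[of 0] by simp
  have bounds: "A * (1 - \<mu>)\<^sup>2 * (\<Sum>k<n. (norm (c k))\<^sup>2) \<le> (norm (\<Sum>k<n. smul (c k) (g k)))\<^sup>2 \<and>
      (norm (\<Sum>k<n. smul (c k) (g k)))\<^sup>2
        \<le> B * (1 + sqrt lam / sqrt B)\<^sup>2 * (\<Sum>k<n. (norm (c k))\<^sup>2)" for n and c :: "nat \<Rightarrow> 'k"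
  proof
    define F where "F = (\<Sum>k<n. smul (c k) (f k))"
    define G where "G = (\<Sum>k<n. smul (c k) (g k))"
    define C where "C = (\<Sum>k<n. (norm (c k))\<^sup>2)"
    have C0: "C \<ge> 0" unfolding C_def by (intro sum_nonneg) simp
    have "F - G = (\<Sum>k<n. smul (c k) (f k - g k))"
      by (simp add: F_def G_def scale_right_diff_distrib sum_subtractf)
    then have FG: "norm (F - G) \<le> (\<Sum>k<n. norm (c k) * d k)"
      by (simp add: d_def norm_smul[symmetric] norm_sum)
    also have "\<dots> \<le> (\<Sum>k<n. norm F * (d k * h k))"
    proof (rule sum_mono)
      fix k assume "k \<in> {..<n}"
      then have "norm (c k) \<le> norm F * h k"
        unfolding F_def h_def by (intro norm_coefficient_le[OF R]) simp
      then show "norm (c k) * d k \<le> norm F * (d k * h k)"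
        using mult_right_mono[OF _ d0[of k]] by (fastforce simp: mult_ac)
    qed
    also have "\<dots> \<le> norm F * \<mu>"
      unfolding sum_distrib_left[symmetric] using part by (intro mult_left_mono) auto
    finally have "(1 - \<mu>) * norm F \<le> norm G"
      using norm_triangle_ineq2[of F G] by (simp add: algebra_simps)
    \<comment> \<open>Squaring keeps the inequality because \<open>\<mu> < 1\<close> makes the left
      side nonnegative.\<close>
    then have "((1 - \<mu>) * norm F)\<^sup>2 \<le> (norm G)\<^sup>2" using assms(4) by (intro power_mono) auto
    moreover have "(1 - \<mu>)\<^sup>2 * (A * C) \<le> (1 - \<mu>)\<^sup>2 * (norm F)\<^sup>2"
      unfolding F_def C_def by (intro mult_left_mono riesz_sequence_lower[OF R]) auto
    ultimately show "A * (1 - \<mu>)\<^sup>2 * C \<le> (norm G)\<^sup>2"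
      by (simp add: power_mult_distrib mult_ac)
    \<comment> \<open>For the upper bound the same estimate of \<open>F - G\<close> is continued by
      Cauchy-Schwarz for finite sums, which brings in \<open>lam\<close> in place of
      \<open>\<mu>\<close>.\<close>
    have "(\<Sum>k<n. norm (c k) * d k)\<^sup>2 \<le> C * (\<Sum>k<n. (d k)\<^sup>2)"
      unfolding C_def by (rule Cauchy_Schwarz_ineq_sum)
    also have "\<dots> \<le> C * lam" using C0 part_lam by (intro mult_left_mono)
    finally have "norm (F - G) \<le> sqrt (C * lam)"
      using FG real_le_rsqrt order_trans by blast
    moreover have "norm F \<le> sqrt (B * C)"
      unfolding F_def C_def by (intro real_le_rsqrt riesz_sequence_upper[OF R])
    \<comment> \<open>Triangle inequality for \<open>G = F - (F - G)\<close>; taking out the factor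
      \<open>sqrt B * sqrt C\<close> then produces the stated constant.\<close>
    ultimately have "norm G \<le> sqrt (B * C) + sqrt (C * lam)"
      using norm_triangle_ineq4[of F "F - G"] by simp
    also have "\<dots> = sqrt B * (1 + sqrt lam / sqrt B) * sqrt C"
      using B by (simp add: real_sqrt_mult field_simps)
    finally have "(norm G)\<^sup>2 \<le> (sqrt B * (1 + sqrt lam / sqrt B) * sqrt C)\<^sup>2"
      by (intro power_mono) auto
    then show "(norm G)\<^sup>2 \<le> B * (1 + sqrt lam / sqrt B)\<^sup>2 * C"
      using B C0 by (simp add: power_mult_distrib)
  qed
  have "sqrt lam / sqrt B \<ge> 0" using lam0 B by simp
  then have "riesz_sequence smul g (A * (1 - \<mu>)\<^sup>2) (B * (1 + sqrt lam / sqrt B)\<^sup>2)"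
    unfolding riesz_sequence_def using A B assms(4) bounds by auto
  with lam show ?thesis unfolding d_def by blast
qed

end
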